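(* Let $\Sigma$ be a one-sided shift space over a countable alphabet and let $(\hat\Sigma,\hat\sigma)$ be the blur shift associated with $\Sigma$ with a finite resolution of blurred sets $\mathscr{V}=\{B_1,\ldots,B_s\}$. Then $$\mathcal{M}(\hat\Sigma,\hat\sigma)=\mathrm{Conv}\Big(\mathcal{M}(\Sigma,\sigma)\ \sqcup\ \{\delta_{(B_r,B_r,\ldots)}:1\le r\le s\}\Big).$$
   Context: The countable alphabet $\mathscr{A}$ is identified with the non-negative integers (discrete topology); $\Sigma\subset\mathscr{A}^{\mathbb{N}}$ is a one-sided shift space (closed, shift-invariant, product topology), points are $x=(x_0,x_1,\ldots)$, and $\sigma$ is the left shift. $\mathscr{L}_0=\{\epsilon\}$ (empty word), $\mathscr{L}_k=\{(x_0,\ldots,x_{k-1}):x\in\Sigma\}$ for $k\ge1$, $\mathscr{L}=\bigcup_{k\ge0}\mathscr{L}_k$; $\ell(w)$ is the length of $w$; $\mathscr{F}_1(w)=\{b\in\mathscr{L}_1:wb\in\mathscr{L}\}$, with $\mathscr{F}_1(\epsilon)=\mathscr{L}_1$. Blur shift: a finite resolution of blurred sets is $\mathscr{V}=\{B_1,\ldots,B_s\}$ where each $B_r\subset\mathscr{L}_1$ is infinite, $B_i\cap B_j$ is finite for $i\ne j$, and $\mathscr{L}_1\setminus\bigcup_{r}B_r$ is finite. Each $B_r$ is treated as a new symbol, and $\hat\Sigma=\Sigma\sqcup\partial_{B_1}\Sigma\sqcup\cdots\sqcup\partial_{B_s}\Sigma$, where $\partial_{B_r}\Sigma=\{(w,B_r,B_r,\ldots):w\in\mathscr{L},\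 \mathscr{F}_1(w)\cap B_r\text{ infinite}\}$ (with $(\epsilon,B_r,B_r,\ldots)=(B_r,B_r,\ldots)$). The topology of $\hat\Sigma$ has as basis the generalized cylinders $Z[w]=\{x\in\hat\Sigma:x_i=w_i,\ 0\le i<\ell(w)\}$ and $Z[wB_r;S]=\{x\in\hat\Sigma:x_i=w_i\text{ for }0\le i<\ell(w),\ x_{\ell(w)}=B_r\text{ or }x_{\ell(w)}\in B_r\setminus S\}$, with $w\in\mathscr{L}$, $1\le r\le s$, $S\subset B_r$ finite; this makes $\hat\Sigma$ a compact metrizable space in which $\Sigma$ is a dense topological subspace. $\hat\sigma:\hat\Sigma\to\hat\Sigma$ is the left shift map (measurable, not continuous at the points $(B_r,B_r,\ldots)$). $\mathcal{M}(\Sigma,\sigma)$ and $\mathcal{M}(\hat\Sigma,\hat\sigma)$ are the sets of $\sigma$-invariant Borel probabilities on $\Sigma$ and of $\hat\sigma$-invariant Borel probabilities on $\hat\Sigma$. A Borel probability $\mu$ on $\Sigma$ is identified with the Borel probability $E\mapsto\mu(E\cap\Sigma)$ on $\hat\Sigma$. $\delta_x$ is the Dirac measure at $x$; $\mathrm{Conv}$ is the convex hull. *)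

theory Defs
  imports "HOL-Probability.Probability"
begin

definition shift :: "(nat \<Rightarrow> 'a) \<Rightarrow> nat \<Rightarrow> 'a" where
  "shift x = (\<lambda>i. x (Suc i))"

text \<open>The type \<^typ>\<open>nat \<Rightarrow> nat\<close> carries the product topology of the discrete topology on \<^typ>\<open>nat\<close>.\<close>

definition shift_space :: "(nat \<Rightarrow> nat) set \<Rightarrow> bool" where
  "shift_space X \<longleftrightarrow> closed X \<and> shift ` X \<subseteq> X"

definition words :: "(nat \<Rightarrow> nat) set \<Rightarrow> nat \<Rightarrow> nat list set" where
  "words X k = (if k = 0 then {[]} else {map x [0..<k] | x. x \<in> X})"

definition language :: "(nat \<Rightarrow> nat) set \<Rightarrow> nat list set" where
  "language X = (\<Union>k. words X k)"

definition letters :: "(nat \<Rightarrow> nat) set \<Rightarrow> nat set" where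
  "letters X = {b. [b] \<in> words X 1}"

definition followers :: "(nat \<Rightarrow> nat) set \<Rightarrow> nat list \<Rightarrow> nat set" where
  "followers X w = {b \<in> letters X. w @ [b] \<in> language X}"

text \<open>A resolution is given as the set of its members. The members are automatically pairwise
  distinct as an indexed family, since repeating an infinite set would give an infinite
  intersection. The empty resolution is possible only when there are finitely many letters.\<close>

definition blur_resolution :: "(nat \<Rightarrow> nat) set \<Rightarrow> nat set set \<Rightarrow> bool" where
  "blur_resolution X V \<longleftrightarrow>
     finite V \<and>
     (\<forall>B\<in>V. B \<subseteq> letters X \<and> infinite B) \<and>
     (\<forall>B\<in>V. \<forall>C\<in>V. B \<noteq> C \<longrightarrow> finite (B \<inter> C)) \<and>
     finite (letters X - \<Union>V)"

datatype blur_symbol = Letter nat | Blurred "nat set"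

definition embed :: "(nat \<Rightarrow> nat) \<Rightarrow> nat \<Rightarrow> blur_symbol" where
  "embed x = (\<lambda>i. Letter (x i))"

definition blur_point :: "nat list \<Rightarrow> nat set \<Rightarrow> nat \<Rightarrow> blur_symbol" where
  "blur_point w B = (\<lambda>i. if i < length w then Letter (w ! i) else Blurred B)"

definition blur_boundary :: "(nat \<Rightarrow> nat) set \<Rightarrow> nat set \<Rightarrow> (nat \<Rightarrow> blur_symbol) set" where
  "blur_boundary X B = {blur_point w B | w. w \<in> language X \<and> infinite (followers X w \<inter> B)}"

definition blur_shift :: "(nat \<Rightarrow> nat) set \<Rightarrow> nat set set \<Rightarrow> (nat \<Rightarrow> blur_symbol) set" where
  "blur_shift X V = embed ` X \<union> (\<Union>B\<in>V. blur_boundary X B)"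

definition cylinder :: "(nat \<Rightarrow> nat) set \<Rightarrow> nat set set \<Rightarrow> nat list \<Rightarrow> (nat \<Rightarrow> blur_symbol) set" where
  "cylinder X V w = {x \<in> blur_shift X V. \<forall>i<length w. x i = Letter (w ! i)}"

definition blur_cylinder ::
  "(nat \<Rightarrow> nat) set \<Rightarrow> nat set set \<Rightarrow> nat list \<Rightarrow> nat set \<Rightarrow> nat set \<Rightarrow> (nat \<Rightarrow> blur_symbol) set" where
  "blur_cylinder X V w B S =
     {x \<in> blur_shift X V. (\<forall>i<length w. x i = Letter (w ! i)) \<and>
        (x (length w) = Blurred B \<or> x (length w) \<in> Letter ` (B - S))}"

definition blur_basis :: "(nat \<Rightarrow> nat) set \<Rightarrow> nat set set \<Rightarrow> (nat \<Rightarrow> blur_symbol) set set" where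
  "blur_basis X V =
     {cylinder X V w | w. w \<in> language X} \<union>
     {blur_cylinder X V w B S | w B S. w \<in> language X \<and> B \<in> V \<and> S \<subseteq> B \<and> finite S}"

definition blur_topology :: "(nat \<Rightarrow> nat) set \<Rightarrow> nat set set \<Rightarrow> (nat \<Rightarrow> blur_symbol) topology" where
  "blur_topology X V = topology_generated_by (blur_basis X V)"

lemma topspace_blur_topology: "topspace (blur_topology X V) = blur_shift X V"
proof -
  have "cylinder X V [] \<in> blur_basis X V"
    by (auto simp: blur_basis_def language_def words_def)
  moreover have "cylinder X V [] = blur_shift X V"
    by (simp add: cylinder_def)
  moreover have "U \<subseteq> blur_shift X V" if "U \<in> blur_basis X V" for U
    using that by (auto simp: blur_basis_def cylinder_def blur_cylinder_def)
  ultimately show ?thesis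
    unfolding blur_topology_def topology_generated_by_topspace by blast
qed

definition borel_of :: "'a topology \<Rightarrow> 'a measure" where
  "borel_of T = sigma (topspace T) {U. openin T U}"

definition invariant_probs :: "'a measure \<Rightarrow> ('a \<Rightarrow> 'a) \<Rightarrow> 'a measure set" where
  "invariant_probs N T =
     {\<mu>. prob_space \<mu> \<and> sets \<mu> = sets N \<and> T \<in> \<mu> \<rightarrow>\<^sub>M \<mu> \<and>
        (\<forall>E\<in>sets \<mu>. emeasure \<mu> (T -` E \<inter> space \<mu>) = emeasure \<mu> E)}"

text \<open>Measures do not form a real vector space, so the library's convex hull does not
  apply; the hull is spelled out as the set of all finite convex combinations.\<close>

definition conv_measures :: "'a measure \<Rightarrow> 'a measure set \<Rightarrow> 'a measure set" where
  "conv_measures N P =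
     {\<mu>. sets \<mu> = sets N \<and>
        (\<exists>F c. finite F \<and> F \<subseteq> P \<and> (\<forall>\<nu>\<in>F. 0 \<le> c \<nu>) \<and> (\<Sum>\<nu>\<in>F. c \<nu>) = (1::real) \<and>
           (\<forall>E\<in>sets N. emeasure \<mu> E = (\<Sum>\<nu>\<in>F. ennreal (c \<nu>) * emeasure \<nu> E)))}"

abbreviation shift_measures :: "(nat \<Rightarrow> nat) set \<Rightarrow> (nat \<Rightarrow> nat) measure set" where
  "shift_measures X \<equiv> invariant_probs (restrict_space borel X) shift"

abbreviation blur_borel :: "(nat \<Rightarrow> nat) set \<Rightarrow> nat set set \<Rightarrow> (nat \<Rightarrow> blur_symbol) measure" where
  "blur_borel X V \<equiv> borel_of (blur_topology X V)"

abbreviation blur_measures :: "(nat \<Rightarrow> nat) set \<Rightarrow> nat set set \<Rightarrow> (nat \<Rightarrow> blur_symbol) measure set" where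
  "blur_measures X V \<equiv> invariant_probs (blur_borel X V) shift"

text \<open>The identification of a measure on \<open>X\<close> with the measure \<open>E \<mapsto> \<mu> (E \<inter> X)\<close> on the blur shift
  is the push-forward along \<^const>\<open>embed\<close>.\<close>

definition extend_measure_blur ::
  "(nat \<Rightarrow> nat) set \<Rightarrow> nat set set \<Rightarrow> (nat \<Rightarrow> nat) measure \<Rightarrow> (nat \<Rightarrow> blur_symbol) measure" where
  "extend_measure_blur X V \<mu> = distr \<mu> (blur_borel X V) embed"

end

theory Submission
  imports Defs
begin

text \<open>
  The decomposition rests on two observations about the shift on the blur shift. A sequence
  of letters stays a sequence of letters under the shift and under taking preimages, so the
  embedded copy of \<open>X\<close> is completely invariant, and the normalised restriction of an invariant
  measure to it is again invariant. On the other hand, for a blurred set \<open>B\<close> the sets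
  \<open>{y. y n = Blurred B}\<close> increase with \<open>n\<close> and each is the preimage of its predecessor. An invariant
  probability gives all of them the same finite mass, so almost every sequence that ever shows
  \<open>B\<close> shows it from the start and is therefore the fixed point \<open>(B, B, \<dots>)\<close>. An
  invariant measure thus lives on the copy of \<open>X\<close> together with finitely many fixed points, and
  splitting it along these pieces gives the convex combination
  (\<open>blur_measure_decomposition\<close>). Conversely, Dirac measures at fixed points and push-forwards
  along the equivariant map \<^const>\<open>embed\<close> are invariant, and invariance survives convex
  combinations.

  The measurability questions are settled by the fact that the Borel sets of the blur shift are
  exactly what the coordinates generate: the basis is countable, a coordinate takes only
  countably many values, and both the cylinders and the sets on which a coordinate has a given
  value can be obtained from each other by countable operations (\<open>measurable_blur_coordinate\<close>,
  \<open>measurable_blur_borelI\<close>).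
\<close>

section \<open>Invariant probabilities and convex combinations\<close>

lemma invariant_probsD:
  assumes "\<mu> \<in> invariant_probs N T"
  shows "prob_space \<mu>" "sets \<mu> = sets N" "space \<mu> = space N" "T \<in> N \<rightarrow>\<^sub>M N"
    "\<And>E. E \<in> sets N \<Longrightarrow> emeasure \<mu> (T -` E \<inter> space N) = emeasure \<mu> E"
proof -
  have m: "prob_space \<mu>" "sets \<mu> = sets N" "T \<in> \<mu> \<rightarrow>\<^sub>M \<mu>"
    "\<And>E. E \<in> sets \<mu> \<Longrightarrow> emeasure \<mu> (T -` E \<inter> space \<mu>) = emeasure \<mu> E"
    using assms by (auto simp: invariant_probs_def)
  show sp: "space \<mu> = space N" using m(2) by (rule sets_eq_imp_space_eq)
  show "prob_space \<mu>" "sets \<mu> = sets N" by fact+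
  show "T \<in> N \<rightarrow>\<^sub>M N" using m(2,3) measurable_cong_sets by blast
  show "emeasure \<mu> (T -` E \<inter> space N) = emeasure \<mu> E" if "E \<in> sets N" for E
    using m(4)[of E] that unfolding sp m(2) .
qed

lemma invariant_probsI:
  assumes "prob_space \<mu>" "sets \<mu> = sets N" "T \<in> N \<rightarrow>\<^sub>M N"
    and "\<And>E. E \<in> sets N \<Longrightarrow> emeasure \<mu> (T -` E \<inter> space N) = emeasure \<mu> E"
  shows "\<mu> \<in> invariant_probs N T"
proof -
  have "T \<in> \<mu> \<rightarrow>\<^sub>M \<mu>" using assms(2,3) measurable_cong_sets by blast
  moreover have "space \<mu> = space N" using assms(2) by (rule sets_eq_imp_space_eq)
  ultimately show ?thesis using assms by (simp add: invariant_probs_def)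
qed

text \<open>The weights in \<^const>\<open>conv_measures\<close> are indexed by the measures themselves. A family
  may repeat a measure; its weights are then added up.\<close>

lemma conv_measures_familyI:
  fixes w :: "'i \<Rightarrow> real"
  assumes "sets \<mu> = sets N" "finite I" "\<And>i. i \<in> I \<Longrightarrow> m i \<in> P" "\<And>i. i \<in> I \<Longrightarrow> 0 \<le> w i"
    and "(\<Sum>i\<in>I. w i) = 1"
    and dec: "\<And>E. E \<in> sets N \<Longrightarrow> emeasure \<mu> E = (\<Sum>i\<in>I. ennreal (w i) * emeasure (m i) E)"
  shows "\<mu> \<in> conv_measures N P"
proof -
  define c where "c = (\<lambda>\<nu>. \<Sum>i\<in>{i\<in>I. m i = \<nu>}. w i)"
  have "(\<Sum>\<nu>\<in>m ` I. c \<nu>) = 1"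
    using sum.image_gen[OF \<open>finite I\<close>, of w m] assms(5) by (simp add: c_def)
  moreover have "0 \<le> c \<nu>" for \<nu>
    unfolding c_def by (intro sum_nonneg) (use assms(4) in auto)
  moreover have "emeasure \<mu> E = (\<Sum>\<nu>\<in>m ` I. ennreal (c \<nu>) * emeasure \<nu> E)" if "E \<in> sets N" for E
  proof -
    have "emeasure \<mu> E = (\<Sum>\<nu>\<in>m ` I. \<Sum>i\<in>{i\<in>I. m i = \<nu>}. ennreal (w i) * emeasure (m i) E)"
      unfolding dec[OF that] by (rule sum.image_gen[OF \<open>finite I\<close>])
    also have "\<dots> = (\<Sum>\<nu>\<in>m ` I. ennreal (c \<nu>) * emeasure \<nu> E)"
    proof (rule sum.cong[OF refl])
      fix \<nu>
      have "ennreal (c \<nu>) = (\<Sum>i\<in>{i\<in>I. m i = \<nu>}. ennreal (w i))"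
        unfolding c_def by (rule sum_ennreal[symmetric]) (use assms(4) in auto)
      then show "(\<Sum>i\<in>{i\<in>I. m i = \<nu>}. ennreal (w i) * emeasure (m i) E) = ennreal (c \<nu>) * emeasure \<nu> E"
        by (simp add: sum_distrib_right)
    qed
    finally show ?thesis .
  qed
  ultimately show ?thesis
    unfolding conv_measures_def using assms(1,2,3)
    by (intro CollectI conjI exI[of _ "m ` I"] exI[of _ c]) auto
qed

lemma conv_measures_subset_invariant_probs:
  assumes P: "P \<subseteq> invariant_probs N T"
  shows "conv_measures N P \<subseteq> invariant_probs N T"
proof
  fix \<mu> assume "\<mu> \<in> conv_measures N P"
  then obtain F c where \<mu>: "sets \<mu> = sets N" and F: "finite F" "F \<subseteq> P"
    and c: "\<forall>\<nu>\<in>F. 0 \<le> c \<nu>" "(\<Sum>\<nu>\<in>F. c \<nu>) = (1::real)"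
    and e: "\<And>E. E \<in> sets N \<Longrightarrow> emeasure \<mu> E = (\<Sum>\<nu>\<in>F. ennreal (c \<nu>) * emeasure \<nu> E)"
    unfolding conv_measures_def by blast
  have sp: "space \<mu> = space N" using \<mu> by (rule sets_eq_imp_space_eq)
  have F': "\<nu> \<in> invariant_probs N T" if "\<nu> \<in> F" for \<nu> using that F(2) P by blast
  obtain \<nu>0 where \<nu>0: "\<nu>0 \<in> F" using c(2) by fastforce
  have T: "T \<in> N \<rightarrow>\<^sub>M N" using invariant_probsD(4)[OF F'[OF \<nu>0]] .
  have "emeasure \<mu> (space \<mu>) = (\<Sum>\<nu>\<in>F. ennreal (c \<nu>))"
    unfolding sp e[OF sets.top]
    by (intro sum.cong refl) (metis F' invariant_probsD(1,3) mult.right_neutral prob_space.emeasure_space_1)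
  also have "\<dots> = 1" using c by (simp add: sum_ennreal)
  finally have "prob_space \<mu>" by (rule prob_spaceI)
  moreover have "emeasure \<mu> (T -` E \<inter> space N) = emeasure \<mu> E" if E: "E \<in> sets N" for E
    unfolding e[OF E] e[OF measurable_sets[OF T E]]
    by (intro sum.cong refl) (simp add: invariant_probsD(5)[OF F' E])
  ultimately show "\<mu> \<in> invariant_probs N T" using \<mu> T by (intro invariant_probsI)
qed

lemma distr_in_invariant_probs:
  assumes \<mu>: "\<mu> \<in> invariant_probs M S" and T: "T \<in> N \<rightarrow>\<^sub>M N" and f: "f \<in> M \<rightarrow>\<^sub>M N"
    and eq: "\<And>x. x \<in> space M \<Longrightarrow> f (S x) = T (f x)"
  shows "distr \<mu> N f \<in> invariant_probs N T"
proof -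
  note m = invariant_probsD[OF \<mu>]
  have f': "f \<in> \<mu> \<rightarrow>\<^sub>M N" using f m(2) measurable_cong_sets by blast
  have "emeasure (distr \<mu> N f) (T -` E \<inter> space N) = emeasure (distr \<mu> N f) E"
    if E: "E \<in> sets N" for E
  proof -
    have "f -` (T -` E \<inter> space N) \<inter> space M = S -` (f -` E \<inter> space M) \<inter> space M"
      using measurable_space[OF f] measurable_space[OF m(4)] eq by auto
    moreover have "f -` E \<inter> space M \<in> sets M" using f E by (rule measurable_sets)
    ultimately show ?thesis
      using m(5)[of "f -` E \<inter> space M"]
      by (simp only: emeasure_distr[OF f' measurable_sets[OF T E]] emeasure_distr[OF f' E] m(3))
  qed
  then show ?thesis
    using T prob_space.prob_space_distr[OF m(1) f'] by (intro invariant_probsI) auto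
qed

lemma return_in_invariant_probs:
  assumes "T \<in> N \<rightarrow>\<^sub>M N" "x \<in> space N" "T x = x"
  shows "return N x \<in> invariant_probs N T"
proof -
  have "emeasure (return N x) (T -` E \<inter> space N) = emeasure (return N x) E" if "E \<in> sets N" for E
    using that measurable_sets[OF assms(1) that] assms by (simp add: indicator_def)
  then show ?thesis
    using prob_space_return[OF assms(2)] assms(1) by (intro invariant_probsI) auto
qed

text \<open>A set \<open>A\<close> and its preimage have the same finite mass, so if one contains the other they
  agree almost everywhere.\<close>

lemma AE_forward_invariant_imp_mem:
  assumes \<mu>: "\<mu> \<in> invariant_probs N T" and A: "A \<in> sets N" and fwd: "A \<subseteq> T -` A"
  shows "AE x in \<mu>. T x \<in> A \<longrightarrow> x \<in> A"
proof -
  interpret prob_space \<mu> by (rule invariant_probsD(1)[OF \<mu>])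
  have m: "A \<in> sets \<mu>" "T \<in> \<mu> \<rightarrow>\<^sub>M \<mu>" "emeasure \<mu> (T -` A \<inter> space \<mu>) = emeasure \<mu> A"
    using \<mu> A by (auto simp: invariant_probs_def)
  have sub: "A \<subseteq> T -` A \<inter> space \<mu>" using fwd sets.sets_into_space[OF m(1)] by blast
  have T: "T -` A \<inter> space \<mu> \<in> sets \<mu>" using m by (rule_tac measurable_sets)
  have "emeasure \<mu> (T -` A \<inter> space \<mu> - A) = 0"
    using emeasure_Diff[OF _ T m(1) sub] m(3) by simp
  then have "T -` A \<inter> space \<mu> - A \<in> null_sets \<mu>" using T m(1) by auto
  from AE_not_in[OF this] show ?thesis
    using AE_space by eventually_elim auto
qed

section \<open>Points of the blur shift\<close>

lemma map_upt_in_language: "x \<in> X \<Longrightarrow> map x [0..<k] \<in> language X"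
  by (auto simp: language_def words_def intro!: exI[of _ k])

lemma language_cases:
  assumes "w \<in> language X"
  obtains "w = []" | x k where "x \<in> X" "w = map x [0..<k]"
  using assms by (auto simp: language_def words_def split: if_splits)

lemma take_in_language:
  assumes "w \<in> language X" shows "take n w \<in> language X"
  using assms
proof (cases rule: language_cases)
  case 1
  with assms show ?thesis by simp
next
  case (2 x k)
  then have "take n w = map x [0..<min n k]" by (simp add: take_map min_def)
  with 2 show ?thesis using map_upt_in_language by metis
qed

lemma map_tl_upt: "map x [Suc 0..<k] = map (shift x) [0..<k - 1]"
  by (rule nth_equalityI) (auto simp: shift_def)

lemma tl_in_language:
  assumes "shift_space X" "w \<in> language X" shows "tl w \<in> language X"
  using assms(2)
proof (cases rule: language_cases)
  case 1
  with assms show ?thesis by simp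
next
  case (2 x k)
  then have "tl w = map (shift x) [0..<k - 1]"
    by (simp add: map_tl[symmetric] map_tl_upt)
  moreover have "shift x \<in> X" using 2 assms(1) by (auto simp: shift_space_def)
  ultimately show ?thesis using map_upt_in_language by metis
qed

lemma blur_shift_cases:
  assumes "y \<in> blur_shift X V"
  obtains x where "x \<in> X" "y = embed x"
  | w B where "w \<in> language X" "B \<in> V" "infinite (followers X w \<inter> B)" "y = blur_point w B"
  using assms by (auto simp: blur_shift_def blur_boundary_def)

lemma embed_in_blur_shift: "x \<in> X \<Longrightarrow> embed x \<in> blur_shift X V"
  by (simp add: blur_shift_def)

lemma fixed_blur_point_in_blur_shift:
  assumes "blur_resolution X V" "B \<in> V"
  shows "blur_point [] B \<in> blur_shift X V"
proof -
  have "[] \<in> language X" by (auto simp: language_def words_def)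
  moreover have "letters X = followers X []"
    by (auto simp: followers_def letters_def language_def)
  then have "infinite (followers X [] \<inter> B)"
    using assms by (metis blur_resolution_def inf.absorb2)
  ultimately show ?thesis using assms(2) by (auto simp: blur_shift_def blur_boundary_def)
qed

lemma shift_embed: "shift (embed x) = embed (shift x)"
  by (simp add: shift_def embed_def)

lemma shift_blur_point: "shift (blur_point w B) = blur_point (tl w) B"
  by (cases w) (auto simp: shift_def blur_point_def)

text \<open>Dropping the first letter of a word can only enlarge its set of followers, so a boundary point
  of \<open>B\<close> is shifted to another boundary point of \<open>B\<close>.\<close>

lemma shift_in_blur_shift:
  assumes X: "shift_space X" and y: "y \<in> blur_shift X V"
  shows "shift y \<in> blur_shift X V"
  using y
proof (cases rule: blur_shift_cases)
  case (1 x)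
  then show ?thesis using X by (auto simp: shift_embed blur_shift_def shift_space_def)
next
  case (2 w B)
  have "followers X w \<subseteq> followers X (tl w)"
  proof (cases "w = []")
    case False
    then have "tl (w @ [b]) = tl w @ [b]" for b by simp
    then show ?thesis using tl_in_language[OF X] by (fastforce simp: followers_def)
  qed simp
  then have "infinite (followers X (tl w) \<inter> B)"
    using 2(3) by (meson finite_subset inf_mono order_refl)
  then show ?thesis
    using 2 tl_in_language[OF X 2(1)] by (auto simp: shift_blur_point blur_shift_def blur_boundary_def)
qed

lemma embed_neq_blur_point: "embed x \<noteq> blur_point w B"
proof
  assume "embed x = blur_point w B"
  then have "embed x (length w) = blur_point w B (length w)" by simp
  then show False by (simp add: embed_def blur_point_def)
qed

lemma blur_symbol_persists:
  assumes "y \<in> blur_shift X V" "y i = Blurred B" "i \<le> j"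
  shows "y j = Blurred B"
  using assms(1)
  by (cases rule: blur_shift_cases)
     (use assms(2,3) in \<open>auto simp: embed_def blur_point_def split: if_splits\<close>)

lemma blur_symbol_values:
  assumes "y \<in> blur_shift X V" shows "y i \<in> range Letter \<union> Blurred ` V"
  using assms by (cases rule: blur_shift_cases) (auto simp: embed_def blur_point_def)

lemma blurred_start_iff:
  assumes "y \<in> blur_shift X V" shows "y 0 = Blurred B \<longleftrightarrow> y = blur_point [] B"
  using blur_symbol_persists[OF assms, of 0 B] by (auto simp: blur_point_def)

lemma embed_image_eq: "embed ` X = {y \<in> blur_shift X V. \<forall>i. y i \<in> range Letter}"
proof
  show "{y \<in> blur_shift X V. \<forall>i. y i \<in> range Letter} \<subseteq> embed ` X"
  proof
    fix y assume y: "y \<in> {y \<in> blur_shift X V. \<forall>i. y i \<in> range Letter}"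
    then have "y \<in> blur_shift X V" by simp
    then show "y \<in> embed ` X"
    proof (cases rule: blur_shift_cases)
      case (2 w B)
      then have "y (length w) \<notin> range Letter" by (auto simp: blur_point_def)
      then show ?thesis using y by blast
    qed simp
  qed
qed (auto simp: blur_shift_def embed_def)

section \<open>Borel sets of the blur shift\<close>

text \<open>By definition the Borel sets come from all open sets, which may be uncountable unions.
  With a countable subbasis, the finite intersections of its members form a countable basis, so
  every open set is a countable union of them.\<close>

lemma sets_borel_of_topology_generated_by:
  assumes "countable S"
  shows "sets (borel_of (topology_generated_by S)) = sigma_sets (\<Union>S) S"
proof -
  have nbhd: "\<forall>x\<in>U. \<exists>F. finite F \<and> F \<noteq> {} \<and> F \<subseteq> S \<and> x \<in> \<Inter>F \<and> \<Inter>F \<subseteq> U"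
    if "generate_topology_on S U" for U
    using that
  proof induction
    case (Int a b)
    show ?case
    proof
      fix x assume "x \<in> a \<inter> b"
      then have x: "x \<in> a" "x \<in> b" by auto
      obtain F where F: "finite F" "F \<noteq> {}" "F \<subseteq> S" "x \<in> \<Inter>F" "\<Inter>F \<subseteq> a"
        using bspec[OF Int.IH(1) x(1)] by blast
      obtain G where G: "finite G" "G \<subseteq> S" "x \<in> \<Inter>G" "\<Inter>G \<subseteq> b"
        using bspec[OF Int.IH(2) x(2)] by blast
      show "\<exists>F. finite F \<and> F \<noteq> {} \<and> F \<subseteq> S \<and> x \<in> \<Inter>F \<and> \<Inter>F \<subseteq> a \<inter> b"
        using F G by (intro exI[of _ "F \<union> G"]) auto
    qed
  next
    case (UN K)
    show ?case
    proof
      fix x assume "x \<in> \<Union>K"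
      then obtain k where k: "k \<in> K" "x \<in> k" by blast
      then show "\<exists>F. finite F \<and> F \<noteq> {} \<and> F \<subseteq> S \<and> x \<in> \<Inter>F \<and> \<Inter>F \<subseteq> \<Union>K"
        using UN.IH[OF k(1)] by (meson Sup_upper order_trans)
    qed
  next
    case (Basis s)
    then show ?case by (intro ballI exI[of _ "{s}"]) auto
  qed auto
  interpret sigma_algebra "\<Union>S" "sigma_sets (\<Union>S) S"
    by (rule sigma_algebra_sigma_sets) auto
  have "U \<in> sigma_sets (\<Union>S) S" if U: "openin (topology_generated_by S) U" for U
  proof -
    define C where "C = {F. (finite F \<and> F \<subseteq> S) \<and> F \<noteq> {} \<and> \<Inter>F \<subseteq> U}"
    have "countable C"
      unfolding C_def
      by (rule countable_subset[OF _ countable_Collect_finite_subset[OF assms]]) auto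
    moreover have "\<Inter>F \<in> sigma_sets (\<Union>S) S" if "F \<in> C" for F
      using that finite_INT[of F "\<lambda>x. x"] by (auto simp: C_def)
    ultimately have "(\<Union>F\<in>C. \<Inter>F) \<in> sigma_sets (\<Union>S) S" by (intro countable_UN'') auto
    moreover have "(\<Union>F\<in>C. \<Inter>F) = U"
    proof
      show "U \<subseteq> (\<Union>F\<in>C. \<Inter>F)"
      proof
        fix x assume "x \<in> U"
        then obtain F where "finite F \<and> F \<noteq> {} \<and> F \<subseteq> S \<and> x \<in> \<Inter>F \<and> \<Inter>F \<subseteq> U"
          using nbhd[of U] U unfolding openin_topology_generated_by_iff by blast
        then have "F \<in> C" "x \<in> \<Inter>F" by (auto simp: C_def)
        then show "x \<in> (\<Union>F\<in>C. \<Inter>F)" by blast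
      qed
    qed (auto simp: C_def)
    ultimately show ?thesis by simp
  qed
  then have 1: "sigma_sets (\<Union>S) {U. openin (topology_generated_by S) U} \<subseteq> sigma_sets (\<Union>S) S"
    by (intro sigma_sets_mono) auto
  have 2: "sigma_sets (\<Union>S) S \<subseteq> sigma_sets (\<Union>S) {U. openin (topology_generated_by S) U}"
    by (intro sigma_sets_subseteq) (auto intro: topology_generated_by_Basis)
  have "sets (borel_of (topology_generated_by S)) =
      sigma_sets (\<Union>S) {U. openin (topology_generated_by S) U}"
    unfolding borel_of_def topology_generated_by_topspace
    by (rule sets_measure_of) (metis (lifting) CollectD PowI openin_subset subsetI topology_generated_by_topspace)
  with 1 2 show ?thesis by simp
qed

lemma Union_blur_basis: "\<Union>(blur_basis X V) = blur_shift X V"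
  using topspace_blur_topology[of X V]
  by (simp add: blur_topology_def topology_generated_by_topspace)

lemma countable_blur_basis:
  assumes "finite V" shows "countable (blur_basis X V)"
proof -
  have "blur_basis X V \<subseteq> range (cylinder X V) \<union>
      (\<lambda>(w, B, S). blur_cylinder X V w B S) ` (UNIV \<times> V \<times> {S. finite S})"
    by (auto simp: blur_basis_def image_iff)
  moreover have "countable {S :: nat set. finite S}"
    using countable_Collect_finite by auto
  then have "countable (range (cylinder X V) \<union>
      (\<lambda>(w, B, S). blur_cylinder X V w B S) ` (UNIV \<times> V \<times> {S. finite S}))"
    using assms by (intro countable_Un countable_image countable_SIGMA) (auto simp: countable_finite)
  ultimately show ?thesis by (rule countable_subset)
qed

lemma space_blur_borel: "space (blur_borel X V) = blur_shift X V"
  by (simp add: borel_of_def space_measure_of_conv topspace_blur_topology)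

lemma sets_blur_borel:
  "finite V \<Longrightarrow> sets (blur_borel X V) = sigma_sets (blur_shift X V) (blur_basis X V)"
  using sets_borel_of_topology_generated_by[OF countable_blur_basis, of V X]
  by (simp add: blur_topology_def Union_blur_basis)

text \<open>The basis only has cylinders over words of the language, but a cylinder over any other
  word is empty.\<close>

lemma cylinder_in_sets:
  assumes "finite V" shows "cylinder X V w \<in> sets (blur_borel X V)"
proof (cases "w \<in> language X")
  case True
  then show ?thesis
    unfolding sets_blur_borel[OF assms] by (intro sigma_sets.Basic) (auto simp: blur_basis_def)
next
  case False
  have "w \<in> language X" if y: "y \<in> blur_shift X V" "\<forall>i<length w. y i = Letter (w ! i)" for y
    using y(1)
  proof (cases rule: blur_shift_cases)
    case (1 x)
    then have "w = map x [0..<length w]"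
      using y(2) by (intro nth_equalityI) (auto simp: embed_def)
    then show ?thesis using map_upt_in_language[OF 1(1)] by metis
  next
    case (2 v B)
    have "i < length v" if "i < length w" for i
      using y(2) that 2(4) by (force simp: blur_point_def split: if_splits)
    then have len: "length w \<le> length v" by (meson not_le_imp_less order.irrefl)
    then have "w = take (length w) v"
      using y(2) 2(4) by (intro nth_equalityI) (auto simp: blur_point_def)
    then show ?thesis using take_in_language[OF 2(1)] by metis
  qed
  then have "cylinder X V w = {}" using False by (auto simp: cylinder_def)
  then show ?thesis by simp
qed

lemma letter_at_in_sets:
  assumes "finite V" shows "{y \<in> blur_shift X V. y i = Letter b} \<in> sets (blur_borel X V)"
proof -
  have "{y \<in> blur_shift X V. y i = Letter b} =
    (\<Union>w\<in>{w. length w = Suc i \<and> w ! i = b}. cylinder X V w)" (is "?L = ?R")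
  proof
    show "?L \<subseteq> ?R"
    proof
      fix y assume y: "y \<in> ?L"
      then have "y \<in> blur_shift X V" by simp
      then show "y \<in> ?R"
      proof (cases rule: blur_shift_cases)
        case (1 x)
        then show ?thesis using y
          by (intro UN_I[of "map x [0..<Suc i]"])
             (auto simp: cylinder_def embed_def nth_append less_Suc_eq)
      next
        case (2 w B)
        then show ?thesis using y
          by (intro UN_I[of "take (Suc i) w"])
             (auto simp: cylinder_def blur_point_def split: if_splits)
      qed
    qed
  qed (auto simp: cylinder_def)
  also have "\<dots> \<in> sets (blur_borel X V)"
    using cylinder_in_sets[OF assms] by (intro sets.countable_UN'') auto
  finally show ?thesis .
qed

text \<open>A sequence that shows \<open>B\<close> at position \<open>i\<close> is \<open>w B B \<dots>\<close> for a word \<open>w\<close> of length at most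
  \<open>i\<close>, and this point is cut out of the generalised cylinder of \<open>w B\<close> by excluding all letters at
  position \<open>length w\<close>.\<close>

lemma blurred_at_in_sets:
  assumes "finite V" shows "{y \<in> blur_shift X V. y i = Blurred B} \<in> sets (blur_borel X V)"
proof (cases "B \<in> V")
  case False
  then have "{y \<in> blur_shift X V. y i = Blurred B} = {}"
    using blur_symbol_values[of _ X V i] by (fastforce simp: image_iff)
  then show ?thesis by (metis sets.empty_sets)
next
  case True
  have "{y \<in> blur_shift X V. y i = Blurred B} =
    (\<Union>w\<in>{w \<in> language X. length w \<le> i}.
       blur_cylinder X V w B {} - (\<Union>b. {y \<in> blur_shift X V. y (length w) = Letter b}))"
    (is "?L = ?R")
  proof
    show "?L \<subseteq> ?R"
    proof
      fix y assume y: "y \<in> ?L"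
      then have "y \<in> blur_shift X V" by simp
      then show "y \<in> ?R"
      proof (cases rule: blur_shift_cases)
        case (1 x)
        then show ?thesis using y by (simp add: embed_def)
      next
        case (2 w C)
        then show ?thesis using y
          by (intro UN_I[of w]) (auto simp: blur_cylinder_def blur_point_def split: if_splits)
      qed
    qed
    show "?R \<subseteq> ?L"
      by (auto simp: blur_cylinder_def intro: blur_symbol_persists)
  qed
  also have "\<dots> \<in> sets (blur_borel X V)"
  proof (intro sets.countable_UN'' sets.Diff)
    fix w assume w: "w \<in> {w \<in> language X. length w \<le> i}"
    then show "blur_cylinder X V w B {} \<in> sets (blur_borel X V)"
      unfolding sets_blur_borel[OF assms] using True
      by (intro sigma_sets.Basic) (auto simp: blur_basis_def)
  qed (use letter_at_in_sets[OF assms] in auto)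
  finally show ?thesis .
qed

lemma measurable_blur_coordinate:
  assumes "finite V" shows "(\<lambda>y. y i) \<in> blur_borel X V \<rightarrow>\<^sub>M count_space UNIV"
proof (rule measurableI)
  fix A :: "blur_symbol set"
  have "(\<lambda>y. y i) -` A \<inter> space (blur_borel X V) =
    (\<Union>a\<in>A \<inter> (range Letter \<union> Blurred ` V). {y \<in> blur_shift X V. y i = a})"
    using blur_symbol_values[of _ X V i] by (auto simp: space_blur_borel)
  also have "\<dots> \<in> sets (blur_borel X V)"
  proof (rule sets.countable_UN'')
    show "countable (A \<inter> (range Letter \<union> Blurred ` V))"
      using assms by (intro countable_Int2) (auto simp: countable_finite)
    show "{y \<in> blur_shift X V. y i = a} \<in> sets (blur_borel X V)" for a
      using letter_at_in_sets[OF assms] blurred_at_in_sets[OF assms] by (cases a) auto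
  qed
  finally show "(\<lambda>y. y i) -` A \<inter> space (blur_borel X V) \<in> sets (blur_borel X V)" .
qed simp

lemma measurable_blur_borelI:
  assumes V: "finite V" and f: "\<And>x. x \<in> space M \<Longrightarrow> f x \<in> blur_shift X V"
    and coord[measurable]: "\<And>i. (\<lambda>x. f x i) \<in> M \<rightarrow>\<^sub>M count_space UNIV"
  shows "f \<in> M \<rightarrow>\<^sub>M blur_borel X V"
proof (rule measurable_sigma_sets[OF sets_blur_borel[OF V]])
  fix U assume "U \<in> blur_basis X V"
  then consider w where "U = cylinder X V w" | w B S where "U = blur_cylinder X V w B S"
    by (auto simp: blur_basis_def)
  then show "f -` U \<inter> space M \<in> sets M"
  proof cases
    case 1
    then have "f -` U \<inter> space M = {x \<in> space M. \<forall>i<length w. f x i = Letter (w ! i)}"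
      using f by (auto simp: cylinder_def)
    also have "\<dots> \<in> sets M" by measurable
    finally show ?thesis .
  next
    case 2
    then have "f -` U \<inter> space M = {x \<in> space M. (\<forall>i<length w. f x i = Letter (w ! i)) \<and>
        f x (length w) \<in> {Blurred B} \<union> Letter ` (B - S)}"
      using f by (auto simp: blur_cylinder_def)
    also have "\<dots> = {x \<in> space M. \<forall>i<length w. f x i = Letter (w ! i)} \<inter>
        ((\<lambda>x. f x (length w)) -` ({Blurred B} \<union> Letter ` (B - S)) \<inter> space M)"
      by blast
    also have "\<dots> \<in> sets M"
    proof (rule sets.Int)
      show "{x \<in> space M. \<forall>i<length w. f x i = Letter (w ! i)} \<in> sets M" by measurable
    qed (rule measurable_sets[OF coord], simp)
    finally show ?thesis .
  qed
qed (use f Union_blur_basis[of X V] in auto)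

lemma measurable_shift_blur:
  assumes "shift_space X" "finite V"
  shows "shift \<in> blur_borel X V \<rightarrow>\<^sub>M blur_borel X V"
  using measurable_blur_coordinate[OF assms(2)] shift_in_blur_shift[OF assms(1)]
  by (intro measurable_blur_borelI assms(2)) (auto simp: space_blur_borel shift_def)

lemma measurable_shift_borel: "shift \<in> (borel :: (nat \<Rightarrow> nat) measure) \<rightarrow>\<^sub>M borel"
  unfolding shift_def by (intro measurable_coordinatewise_then_product) simp

lemma measurable_embed:
  assumes "finite V"
  shows "embed \<in> restrict_space borel X \<rightarrow>\<^sub>M blur_borel X V"
proof (rule measurable_blur_borelI[OF assms])
  have coord: "(\<lambda>x :: nat \<Rightarrow> nat. x i) \<in> borel \<rightarrow>\<^sub>M count_space UNIV" for i
    using measurable_product_coordinates[of i] measurable_cong_sets[OF refl sets_borel_eq_count_space]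
    by blast
  show "(\<lambda>x. embed x i) \<in> restrict_space borel X \<rightarrow>\<^sub>M count_space UNIV" for i
    unfolding embed_def
    by (rule measurable_restrict_space1[OF measurable_compose[OF coord]]) simp
qed (auto simp: embed_in_blur_shift space_restrict_space)

lemma embed_image_in_sets:
  assumes "finite V" shows "embed ` X \<in> sets (blur_borel X V)"
proof -
  have [measurable]: "Measurable.pred (blur_borel X V) (\<lambda>y. y i \<in> range Letter)" for i
    by (rule measurable_compose[OF measurable_blur_coordinate[OF assms]]) simp
  have "embed ` X = {y \<in> space (blur_borel X V). \<forall>i. y i \<in> range Letter}"
    using embed_image_eq by (simp add: space_blur_borel)
  also have "\<dots> \<in> sets (blur_borel X V)" by measurable
  finally show ?thesis .
qed

lemma fixed_blur_point_in_sets: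
  assumes "blur_resolution X V" "B \<in> V" shows "{blur_point [] B} \<in> sets (blur_borel X V)"
proof -
  have "{blur_point [] B} = {y \<in> blur_shift X V. y 0 = Blurred B}"
    using blurred_start_iff fixed_blur_point_in_blur_shift[OF assms] by auto
  then show ?thesis using blurred_at_in_sets assms(1) by (simp add: blur_resolution_def)
qed

section \<open>Decomposition of invariant measures\<close>

text \<open>The value at blurred symbols is a dummy; the map serves as an inverse of
  \<^const>\<open>embed\<close>.\<close>

definition unembed :: "(nat \<Rightarrow> blur_symbol) \<Rightarrow> nat \<Rightarrow> nat" where
  "unembed y = (\<lambda>i. case y i of Letter n \<Rightarrow> n | Blurred _ \<Rightarrow> 0)"

lemma unembed_embed: "unembed (embed x) = x"
  by (simp add: unembed_def embed_def)

lemma measurable_unembed: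
  assumes "finite V" shows "unembed \<in> blur_borel X V \<rightarrow>\<^sub>M borel"
  unfolding unembed_def
proof (rule measurable_coordinatewise_then_product)
  fix i
  show "(\<lambda>y. case y i of Letter n \<Rightarrow> n | Blurred _ \<Rightarrow> 0) \<in> blur_borel X V \<rightarrow>\<^sub>M borel"
    by (rule measurable_compose[OF measurable_blur_coordinate[OF assms]]) simp
qed

lemma AE_embedded_or_fixed:
  assumes X: "shift_space X" and V: "blur_resolution X V" and \<mu>: "\<mu> \<in> blur_measures X V"
  shows "AE y in \<mu>. y \<in> embed ` X \<or> (\<exists>B\<in>V. y = blur_point [] B)"
proof -
  have fin: "finite V" using V by (simp add: blur_resolution_def)
  have sp: "space \<mu> = blur_shift X V"
    using invariant_probsD(2,3)[OF \<mu>] by (simp_all add: space_blur_borel)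
  have "AE y in \<mu>. y (Suc n) = Blurred B \<longrightarrow> y n = Blurred B" for n B
  proof -
    let ?A = "{y \<in> blur_shift X V. y n = Blurred B}"
    have "?A \<subseteq> shift -` ?A"
      using shift_in_blur_shift[OF X] blur_symbol_persists[of _ X V n B "Suc n"]
      by (auto simp: shift_def)
    from AE_forward_invariant_imp_mem[OF \<mu> blurred_at_in_sets[OF fin] this] AE_space
    show ?thesis
      by eventually_elim (use shift_in_blur_shift[OF X] sp in \<open>auto simp: shift_def\<close>)
  qed
  then have "AE y in \<mu>. \<forall>B\<in>V. \<forall>n. y (Suc n) = Blurred B \<longrightarrow> y n = Blurred B"
    by (intro AE_ball_countable[THEN iffD2]) (auto simp: AE_all_countable countable_finite fin)
  then show ?thesis using AE_space
  proof eventually_elim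
    case (elim y)
    then have y: "y \<in> blur_shift X V" using sp by simp
    then show ?case
    proof (cases rule: blur_shift_cases)
      case (2 w B)
      have "y (Suc n) = Blurred B \<Longrightarrow> y n = Blurred B" for n
        using elim(1) 2(2) by blast
      then have "y n = Blurred B \<Longrightarrow> y 0 = Blurred B" for n
        by (induction n) blast+
      moreover have "y (length w) = Blurred B" using 2(4) by (simp add: blur_point_def)
      ultimately have "y 0 = Blurred B" .
      then show ?thesis using blurred_start_iff[OF y] 2(2) by blast
    qed simp
  qed
qed

lemma emeasure_blur_measure_split:
  assumes X: "shift_space X" and V: "blur_resolution X V" and \<mu>: "\<mu> \<in> blur_measures X V"
    and E: "E \<in> sets (blur_borel X V)"
  shows "emeasure \<mu> E = emeasure \<mu> (E \<inter> embed ` X) +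
    (\<Sum>B\<in>V. emeasure \<mu> {blur_point [] B} * indicator E (blur_point [] B))"
proof -
  have fin: "finite V" using V by (simp add: blur_resolution_def)
  have s: "sets \<mu> = sets (blur_borel X V)" using \<mu> by (auto simp: invariant_probs_def)
  have XE: "E \<inter> embed ` X \<in> sets \<mu>" using E embed_image_in_sets[OF fin] s by auto
  have BE: "E \<inter> {blur_point [] B} \<in> sets \<mu>" if "B \<in> V" for B
    using E fixed_blur_point_in_sets[OF V that] s by auto
  have inj: "blur_point [] B = blur_point [] C \<longleftrightarrow> B = C" for B C
    by (auto simp: blur_point_def fun_eq_iff)
  have UB: "(\<Union>B\<in>V. E \<inter> {blur_point [] B}) \<in> sets \<mu>"
    by (rule sets.finite_UN[OF fin BE])
  have "emeasure \<mu> E = emeasure \<mu> ((E \<inter> embed ` X) \<union> (\<Union>B\<in>V. E \<inter> {blur_point [] B}))"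
  proof (rule emeasure_eq_AE)
    show "AE y in \<mu>. y \<in> E \<longleftrightarrow> y \<in> (E \<inter> embed ` X) \<union> (\<Union>B\<in>V. E \<inter> {blur_point [] B})"
      using AE_embedded_or_fixed[OF X V \<mu>] by eventually_elim blast
    show "E \<in> sets \<mu>" using E s by simp
  qed (rule sets.Un[OF XE UB])
  also have "\<dots> = emeasure \<mu> (E \<inter> embed ` X) + emeasure \<mu> (\<Union>B\<in>V. E \<inter> {blur_point [] B})"
  proof (rule plus_emeasure[symmetric, OF XE UB])
    show "(E \<inter> embed ` X) \<inter> (\<Union>B\<in>V. E \<inter> {blur_point [] B}) = {}"
      by (auto simp: embed_neq_blur_point)
  qed
  also have "emeasure \<mu> (\<Union>B\<in>V. E \<inter> {blur_point [] B}) = (\<Sum>B\<in>V. emeasure \<mu> (E \<inter> {blur_point [] B}))"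
  proof (rule sum_emeasure[symmetric])
    show "disjoint_family_on (\<lambda>B. E \<inter> {blur_point [] B}) V"
      by (auto simp: disjoint_family_on_def inj)
  qed (use BE fin in auto)
  also have "\<dots> = (\<Sum>B\<in>V. emeasure \<mu> {blur_point [] B} * indicator E (blur_point [] B))"
    by (intro sum.cong) (auto simp: indicator_def)
  finally show ?thesis .
qed

text \<open>The measure on \<open>X\<close> is the conditional measure given the embedded copy of \<open>X\<close>, carried back
  by the inverse of \<^const>\<open>embed\<close>. It is invariant because the shift of a boundary point is
  again a boundary point, so that the copy of \<open>X\<close> is its own preimage.\<close>

lemma shift_measure_from_blur_measure:
  assumes X: "shift_space X" and V: "finite V" and \<mu>: "\<mu> \<in> blur_measures X V"
    and pos: "emeasure \<mu> (embed ` X) \<noteq> 0"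
  shows "\<exists>\<nu>\<in>shift_measures X. \<forall>E\<in>sets (blur_borel X V).
    emeasure (extend_measure_blur X V \<nu>) E = emeasure \<mu> (E \<inter> embed ` X) / emeasure \<mu> (embed ` X)"
proof -
  interpret prob_space \<mu> by (rule invariant_probsD(1)[OF \<mu>])
  have s: "sets \<mu> = sets (blur_borel X V)" and sp: "space \<mu> = blur_shift X V"
    and inv: "\<And>E. E \<in> sets \<mu> \<Longrightarrow> emeasure \<mu> (shift -` E \<inter> blur_shift X V) = emeasure \<mu> E"
    using invariant_probsD(2,3,5)[OF \<mu>] by (simp_all add: space_blur_borel)
  have Xb: "X \<in> sets borel" using X by (auto simp: shift_space_def)
  have eX: "embed ` X \<in> sets \<mu>" using embed_image_in_sets[OF V] s by simp
  define U where "U = uniform_measure \<mu> (embed ` X)"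
  have sU: "sets U = sets (blur_borel X V)" and spU: "space U = blur_shift X V"
    by (simp_all add: U_def s sp)
  have un: "unembed \<in> U \<rightarrow>\<^sub>M borel" "unembed \<in> \<mu> \<rightarrow>\<^sub>M borel"
    using measurable_unembed[OF V] sU s measurable_cong_sets by blast+
  define \<nu> where "\<nu> = restrict_space (distr U borel unembed) X"
  have s\<nu>: "sets \<nu> = sets (restrict_space borel X)" "space \<nu> = X"
    unfolding \<nu>_def by (rule sets_restrict_space_cong) (simp_all add: space_restrict_space)
  have img: "embed ` A = unembed -` A \<inter> embed ` X" if "A \<subseteq> X" for A
    using that by (auto simp: unembed_embed)
  have imgs: "embed ` A \<in> sets \<mu>" if "A \<in> sets borel" "A \<subseteq> X" for A
  proof -
    have "embed ` A = (unembed -` A \<inter> space \<mu>) \<inter> embed ` X"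
      using img[OF that(2)] sets.sets_into_space[OF eX] by blast
    then show ?thesis using measurable_sets[OF un(2) that(1)] eX by auto
  qed
  have sets\<nu>D: "A \<in> sets borel \<and> A \<subseteq> X" if "A \<in> sets \<nu>" for A
    using that Xb by (auto simp: s\<nu> sets_restrict_space)
  have e\<nu>: "emeasure \<nu> A = emeasure \<mu> (embed ` A) / emeasure \<mu> (embed ` X)"
    if "A \<in> sets \<nu>" for A
  proof -
    have A: "A \<in> sets borel" "A \<subseteq> X" using sets\<nu>D[OF that] by auto
    have "emeasure \<nu> A = emeasure U (unembed -` A \<inter> space U)"
      unfolding \<nu>_def using A Xb
      by (subst emeasure_restrict_space) (auto simp: emeasure_distr[OF un(1)])
    also have "\<dots> = emeasure \<mu> (embed ` X \<inter> (unembed -` A \<inter> space U)) / emeasure \<mu> (embed ` X)"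
      unfolding U_def by (rule emeasure_uniform_measure[OF eX])
        (use measurable_sets[OF un(2) A(1)] in simp)
    also have "embed ` X \<inter> (unembed -` A \<inter> space U) = embed ` A"
      using img[OF A(2)] sets.sets_into_space[OF eX] spU sp by blast
    finally show ?thesis .
  qed
  have "emeasure \<nu> (space \<nu>) = 1"
    using e\<nu>[OF sets.top] pos by (simp add: s\<nu> less_top[symmetric])
  then have "prob_space \<nu>" by (rule prob_spaceI)
  have shX: "shift \<in> restrict_space borel X \<rightarrow>\<^sub>M restrict_space borel X"
    using X measurable_shift_borel
    by (intro measurable_restrict_space3) (auto simp: shift_space_def)
  have sh\<nu>: "shift \<in> \<nu> \<rightarrow>\<^sub>M \<nu>" using shX s\<nu>(1) measurable_cong_sets by blast
  have "emeasure \<nu> (shift -` A \<inter> space \<nu>) = emeasure \<nu> A" if A: "A \<in> sets \<nu>" for A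
  proof -
    have AX: "A \<subseteq> X" "A \<in> sets borel" using sets\<nu>D[OF A] by auto
    have "embed ` (shift -` A \<inter> X) = shift -` embed ` A \<inter> blur_shift X V"
    proof
      show "embed ` (shift -` A \<inter> X) \<subseteq> shift -` embed ` A \<inter> blur_shift X V"
        by (auto simp: shift_embed embed_in_blur_shift)
      show "shift -` embed ` A \<inter> blur_shift X V \<subseteq> embed ` (shift -` A \<inter> X)"
      proof
        fix y assume y: "y \<in> shift -` embed ` A \<inter> blur_shift X V"
        then have "y \<in> blur_shift X V" by simp
        then show "y \<in> embed ` (shift -` A \<inter> X)"
        proof (cases rule: blur_shift_cases)
          case (1 x)
          then have "embed (shift x) \<in> embed ` A" using y by (simp add: shift_embed)
          then have "shift x \<in> A" by (metis imageE unembed_embed)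
          then show ?thesis using 1 by simp
        next
          case (2 w B)
          then have "blur_point (tl w) B \<in> range embed" using y by (auto simp: shift_blur_point)
          then show ?thesis by (metis embed_neq_blur_point imageE)
        qed
      qed
    qed
    then have "emeasure \<mu> (embed ` (shift -` A \<inter> X)) = emeasure \<mu> (embed ` A)"
      using inv[OF imgs[OF AX(2,1)]] by simp
    then show ?thesis using e\<nu>[OF A] e\<nu>[OF measurable_sets[OF sh\<nu> A]] s\<nu>(2) by simp
  qed
  then have "\<nu> \<in> shift_measures X"
    using \<open>prob_space \<nu>\<close> sh\<nu> s\<nu>(1) by (auto simp: invariant_probs_def)
  moreover have "emeasure (extend_measure_blur X V \<nu>) E =
      emeasure \<mu> (E \<inter> embed ` X) / emeasure \<mu> (embed ` X)" if E: "E \<in> sets (blur_borel X V)" for E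
  proof -
    have em: "embed \<in> \<nu> \<rightarrow>\<^sub>M blur_borel X V"
      using measurable_embed[OF V] s\<nu>(1) measurable_cong_sets by blast
    have "embed ` (embed -` E \<inter> space \<nu>) = E \<inter> embed ` X" using s\<nu>(2) by auto
    then show ?thesis
      unfolding extend_measure_blur_def emeasure_distr[OF em E] e\<nu>[OF measurable_sets[OF em E]]
      by simp
  qed
  ultimately show ?thesis by blast
qed

lemma blur_measure_decomposition:
  assumes X: "shift_space X" and V: "blur_resolution X V" and \<mu>: "\<mu> \<in> blur_measures X V"
  shows "\<mu> \<in> conv_measures (blur_borel X V)
    (extend_measure_blur X V ` shift_measures X \<union>
     {return (blur_borel X V) (blur_point [] B) | B. B \<in> V})"
    (is "_ \<in> conv_measures _ ?P")
proof -
  interpret prob_space \<mu> by (rule invariant_probsD(1)[OF \<mu>])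
  have fin: "finite V" using V by (simp add: blur_resolution_def)
  have s: "sets \<mu> = sets (blur_borel X V)" and sp: "space \<mu> = blur_shift X V"
    using invariant_probsD(2,3)[OF \<mu>] by (simp_all add: space_blur_borel)
  define p where "p = measure \<mu> (embed ` X)"
  have p: "emeasure \<mu> (embed ` X) = ennreal p" by (simp add: p_def emeasure_eq_measure)
  have "\<exists>\<nu>. p \<noteq> 0 \<longrightarrow> \<nu> \<in> shift_measures X \<and> (\<forall>E\<in>sets (blur_borel X V).
      emeasure (extend_measure_blur X V \<nu>) E = emeasure \<mu> (E \<inter> embed ` X) / emeasure \<mu> (embed ` X))"
    using shift_measure_from_blur_measure[OF X fin \<mu>] p by (cases "p = 0") (auto simp: p_def)
  then obtain \<nu> where \<nu>: "p \<noteq> 0 \<Longrightarrow> \<nu> \<in> shift_measures X"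
    and \<nu>E: "\<And>E. p \<noteq> 0 \<Longrightarrow> E \<in> sets (blur_borel X V) \<Longrightarrow>
      emeasure (extend_measure_blur X V \<nu>) E = emeasure \<mu> (E \<inter> embed ` X) / ennreal p"
    unfolding p by blast
  \<comment> \<open>\<open>None\<close> indexes the part carried by the copy of \<open>X\<close>. It must be left out if that part has
     mass 0, since \<open>X\<close> may then carry no invariant probability at all.\<close>
  define I where "I = (if p = 0 then {} else {None}) \<union> Some ` V"
  define w where "w i = (case i of None \<Rightarrow> p | Some B \<Rightarrow> measure \<mu> {blur_point [] B})" for i
  define m where "m i = (case i of None \<Rightarrow> extend_measure_blur X V \<nu>
      | Some B \<Rightarrow> return (blur_borel X V) (blur_point [] B))" for i
  have sumI: "(\<Sum>i\<in>I. f i) = (if p = 0 then 0 else f None) + (\<Sum>B\<in>V. f (Some B))"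
    for f :: "nat set option \<Rightarrow> 'b::comm_monoid_add"
    unfolding I_def using fin
    by (subst sum.union_disjoint) (auto simp: sum.reindex)
  have w0: "0 \<le> w i" for i by (auto simp: w_def p_def split: option.split)
  have dec: "emeasure \<mu> E = (\<Sum>i\<in>I. ennreal (w i) * emeasure (m i) E)"
    if E: "E \<in> sets (blur_borel X V)" for E
  proof -
    have "emeasure \<mu> (E \<inter> embed ` X) = (if p = 0 then 0 else ennreal p * emeasure (extend_measure_blur X V \<nu>) E)"
    proof (cases "p = 0")
      case True
      have "emeasure \<mu> (E \<inter> embed ` X) \<le> emeasure \<mu> (embed ` X)"
        using embed_image_in_sets[OF fin] s by (intro emeasure_mono) auto
      then show ?thesis using True p by simp
    next
      case False
      then have "ennreal p \<noteq> 0" by (simp add: p_def)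
      then show ?thesis
        using False by (simp add: \<nu>E[OF False E] ennreal_times_divide mult_divide_eq_ennreal
          mult.commute[of "ennreal p"])
    qed
    moreover have "(\<Sum>B\<in>V. emeasure \<mu> {blur_point [] B} * indicator E (blur_point [] B)) =
        (\<Sum>B\<in>V. ennreal (w (Some B)) * emeasure (m (Some B)) E)"
      by (rule sum.cong) (simp_all add: w_def m_def E emeasure_eq_measure)
    ultimately show ?thesis
      using emeasure_blur_measure_split[OF X V \<mu> E] by (simp add: sumI) (simp add: w_def m_def)
  qed
  have m: "m i \<in> ?P" if "i \<in> I" for i
    using that \<nu> by (auto simp: I_def m_def split: if_splits)
  have "emeasure (m i) (blur_shift X V) = 1" if "i \<in> I" for i
  proof (cases i)
    case None
    then have "p \<noteq> 0" using that by (auto simp: I_def split: if_splits)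
    moreover have "blur_shift X V \<inter> embed ` X = embed ` X" by (auto simp: embed_in_blur_shift)
    ultimately show ?thesis
      using None \<nu>E[of "blur_shift X V"] sets.top[of "blur_borel X V"] p
      by (simp add: m_def space_blur_borel p_def)
  next
    case (Some B)
    then have "B \<in> V" using that by (auto simp: I_def split: if_splits)
    then show ?thesis
      using Some sets.top[of "blur_borel X V"] fixed_blur_point_in_blur_shift[OF V]
      by (simp add: m_def space_blur_borel)
  qed
  then have "emeasure \<mu> (blur_shift X V) = (\<Sum>i\<in>I. ennreal (w i))"
    using dec[of "blur_shift X V"] sets.top[of "blur_borel X V"] by (simp add: space_blur_borel)
  then have "ennreal (\<Sum>i\<in>I. w i) = 1" using emeasure_space_1 sp w0 by (simp add: sum_ennreal)
  then have "(\<Sum>i\<in>I. w i) = 1" using w0 by (metis ennreal_eq_1)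
  then show ?thesis
    using s m w0 dec fin by (intro conv_measures_familyI[where I = I and m = m and w = w]) (auto simp: I_def)
qed

theorem proposition3p4:
  fixes X :: "(nat \<Rightarrow> nat) set" and V :: "nat set set"
  assumes "shift_space X" and "blur_resolution X V"
  shows "disjnt (extend_measure_blur X V ` shift_measures X)
                {return (blur_borel X V) (blur_point [] B) | B. B \<in> V} \<and>
         blur_measures X V =
           conv_measures (blur_borel X V)
             (extend_measure_blur X V ` shift_measures X \<union>
              {return (blur_borel X V) (blur_point [] B) | B. B \<in> V})"
proof
  have fin: "finite V" using assms(2) by (simp add: blur_resolution_def)
  note sh = measurable_shift_blur[OF assms(1) fin]
  note em = measurable_embed[OF fin, of X]
  show "disjnt (extend_measure_blur X V ` shift_measures X)
    {return (blur_borel X V) (blur_point [] B) | B. B \<in> V}"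
  proof -
    have "extend_measure_blur X V \<mu> \<noteq> return (blur_borel X V) (blur_point [] B)"
      if \<mu>: "\<mu> \<in> shift_measures X" and B: "B \<in> V" for \<mu> B
    proof
      note sB = fixed_blur_point_in_sets[OF assms(2) B]
      have em': "embed \<in> \<mu> \<rightarrow>\<^sub>M blur_borel X V"
        using em \<mu> measurable_cong_sets unfolding invariant_probs_def by blast
      have "embed -` {blur_point [] B} = {}" by (auto simp: embed_neq_blur_point)
      then have "emeasure (extend_measure_blur X V \<mu>) {blur_point [] B} = 0"
        unfolding extend_measure_blur_def emeasure_distr[OF em' sB] by simp
      moreover assume "extend_measure_blur X V \<mu> = return (blur_borel X V) (blur_point [] B)"
      ultimately show False using sB by simp
    qed
    then show ?thesis by (force simp: disjnt_iff)
  qed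
  have "extend_measure_blur X V ` shift_measures X \<subseteq> blur_measures X V"
    unfolding extend_measure_blur_def
    by (intro image_subsetI distr_in_invariant_probs[OF _ sh em]) (auto simp: shift_embed)
  moreover have "return (blur_borel X V) (blur_point [] B) \<in> blur_measures X V" if "B \<in> V" for B
    using fixed_blur_point_in_blur_shift[OF assms(2) that]
    by (intro return_in_invariant_probs[OF sh]) (auto simp: space_blur_borel shift_blur_point)
  ultimately have "extend_measure_blur X V ` shift_measures X \<union>
      {return (blur_borel X V) (blur_point [] B) | B. B \<in> V} \<subseteq> blur_measures X V"
    by blast
  from conv_measures_subset_invariant_probs[OF this]
  show "blur_measures X V = conv_measures (blur_borel X V)
      (extend_measure_blur X V ` shift_measures X \<union>
       {return (blur_borel X V) (blur_point [] B) | B. B \<in> V})"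
    using blur_measure_decomposition[OF assms] by blast
qed

end
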